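(* A morphism of abstract cluster structures (respectively, of abstract quantum cluster structures) $(F,\chi,\alpha)$ is an isomorphism in the category $\mathbf{ACS}$ of abstract cluster structures (respectively, in the category $\mathbf{AQCS}$ of abstract quantum cluster structures) if and only if $F$ is an isomorphism of categories and $\chi$ and $\alpha$ are natural isomorphisms.
   Context: Ab is the category of abelian groups; $A^*=\mathrm{Hom}_{\mathbb Z}(A,\mathbb Z)$; for $F\colon\mathcal C\to \mathrm{Ab}$, $F^*\colon\mathcal C^{op}\to\mathrm{Ab}$ is $F^*c=(Fc)^*$, $F^*f=(Ff)^*$. Signed path category. Let $E$ be a simple directed graph (no loops, at most one arrow with given source and target; 2-cycles allowed). $E_\pm$ has the same vertices and, for each arrow $\alpha\colon c\to d$ of $E$, two arrows $\alpha^+,\alpha^-\colon c\to d$. $\mathcal E(E)$ is the quotient of the path category of $E_\pm$ by the relations $\gamma^-\circ\alpha^+=\mathrm{id}_c$ and $\gamma^+\circ\alpha^-=\mathrm{id}_c$ whenever $\alpha\colon c\to d$ and $\gamma\colon d\to c$ are arrows of $E$. Pairing. For $F\colon\mathcal C\to\mathrm{Ab}$ and $G\colon\mathcal C^{op}\to\mathrm{Ab}$, a pairing $\langle-,-\rangle\colon F\otimes_{\mathbb Z}G\to\underline{\mathbb Z}$ is a dinatural transformation, i.e. a family of bilinear forms $\langle-,-\rangle_c\colon Fc\times Gc\to\mathbb Z$ with $\langle a,Gf(b)\rangle_c=\langle Ff(a),b\rangle_d$ for all $f\colon c\to d$, $a\in Fc$, $b\in Gd$. It is right non-degenerate if each $\delta_{Gc}\colon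 Gc\to (Fc)^*$, $b\mapsto\langle-,b\rangle_c$, is injective. A free abelian sheaf is a functor to Ab of the form $\mathrm{Free}_{\mathbb Z}\circ\mathcal B$ with $\mathcal B$ a Set-valued functor on the same domain. Factorization. For $\mathcal P\colon\mathcal E^{op}\to\mathrm{Ab}$ and $\mathcal Q\colon\mathcal E\to\mathrm{Ab}$, a factorization $\mathcal P\to\mathcal Q$ is a family $\theta_c\colon\mathcal Pc\to\mathcal Qc$ with $\theta_d=\mathcal Qf\circ\theta_c\circ\mathcal Pf$ for all $f\colon c\to d$ in $\mathcal E$; a factorization $\mathcal Q\to\mathcal P$ is a family $\theta_c\colon\mathcal Qc\to\mathcal Pc$ with $\theta_c=\mathcal Pf\circ\theta_d\circ\mathcal Qf$. Abstract cluster structure over $E$: a tuple $(\mathcal E,\mathcal X,\beta,\mathcal A,\langle-,-\rangle)$ with $\mathcal E=\mathcal E(E)$, $\mathcal X\colon\mathcal E^{op}\to\mathrm{Ab}$ and $\mathcal A\colon\mathcal E\to\mathrm{Ab}$ free abelian sheaves, $\beta\colon\mathcal X\to\mathcal A$ a factorization, $\langle-,-\rangle\colon\mathcal A\otimes_{\mathbb Z}\mathcal X\to\underline{\mathbb Z}$ a right non-degenerate pairing. Abstract quantum cluster structure: a tuple $(\mathcal E,\mathcal X,\beta,\lambda,\mathcal A,\langle-,-\rangle)$ where $(\mathcal E,\mathcal X,\beta,\mathcal A,\langle-,-\rangle)$ is an abstract cluster structure and $\lambda\colon\mathcal A\to\mathcal A^*$ is a factorization of the form $\lambda=\delta_{\mathcal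 X}\circ\rho$, with $\rho\colon\mathcal A\to\mathcal X$ a factorization such that $\rho_c\circ\beta_c=\mathrm{id}_{\mathcal Xc}$ for all $c$, and $\delta_{\mathcal X}\colon\mathcal X\to\mathcal A^*$ given by $\delta_{\mathcal Xc}(x)=\langle-,x\rangle_c$. A morphism in $\mathbf{AQCS}$ from $(\mathcal E_1,\mathcal X_1,\beta_1,\lambda_1,\mathcal A_1,\langle-,-\rangle^1)$ to $(\mathcal E_2,\mathcal X_2,\beta_2,\lambda_2,\mathcal A_2,\langle-,-\rangle^2)$ is a tuple $(F,\chi,\alpha)$ with $F\colon\mathcal E_1\to\mathcal E_2$ a functor, $\chi\colon\mathcal X_1\to\mathcal X_2F^{op}$ and $\alpha\colon\mathcal A_1\to\mathcal A_2F$ natural transformations, such that for all $c$: (p) $\alpha_c\circ(\beta_1)_c=(\beta_2)_{Fc}\circ\chi_c$ and (q) $(\lambda_1)_c=(\alpha_c)^*\circ(\lambda_2)_{Fc}\circ\alpha_c$. A morphism in $\mathbf{ACS}$ is the same, omitting (q). Composition is $(G,\chi',\alpha')\circ(F,\chi,\alpha)=(G\circ F,\chi'\circ\chi,\alpha'\circ\alpha)$ with $(\chi'\circ\chi)_c=\chi'_{Fc}\circ\chi_c$, $(\alpha'\circ\alpha)_c=\alpha'_{Fc}\circ\alpha_c$; identities are $(\mathrm{id},\mathrm{id},\mathrm{id})$. *)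

theory Defs
  imports "HOL-Algebra.Free_Abelian_Groups" "HOL-Library.FuncSet" "Graph_Theory.Pair_Digraph"
begin

section \<open>Categories, functors and natural transformations\<close>

text \<open>
  Functors, natural transformations and set functions are total HOL functions that are
  \<open>undefined\<close> outside their domain (as in \<^theory>\<open>HOL-Library.FuncSet\<close>). Equality of HOL terms
  is therefore equality of functors, of families and of homomorphisms.
\<close>

record ('o, 'm) cat =
  Obj :: "'o set"
  Arr :: "'m set"
  Dom :: "'m \<Rightarrow> 'o"
  Cod :: "'m \<Rightarrow> 'o"
  Idn :: "'o \<Rightarrow> 'm"
  Cmp :: "'m \<Rightarrow> 'm \<Rightarrow> 'm"  \<comment> \<open>\<open>Cmp C g f\<close> is \<open>g \<circ> f\<close>\<close>

text \<open>
  The following laws are nowhere assumed: they are provable for the categories constructed below,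
  which are the only ones occurring in the definition of cluster structures.
\<close>

locale category =
  fixes C :: "('o, 'm) cat"
  assumes Dom_in: "f \<in> Arr C \<Longrightarrow> Dom C f \<in> Obj C"
    and Cod_in: "f \<in> Arr C \<Longrightarrow> Cod C f \<in> Obj C"
    and Idn_in: "c \<in> Obj C \<Longrightarrow> Idn C c \<in> Arr C"
    and Dom_Idn: "c \<in> Obj C \<Longrightarrow> Dom C (Idn C c) = c"
    and Cod_Idn: "c \<in> Obj C \<Longrightarrow> Cod C (Idn C c) = c"
    and Cmp_in: "\<lbrakk>f \<in> Arr C; g \<in> Arr C; Dom C g = Cod C f\<rbrakk> \<Longrightarrow> Cmp C g f \<in> Arr C"
    and Dom_Cmp: "\<lbrakk>f \<in> Arr C; g \<in> Arr C; Dom C g = Cod C f\<rbrakk> \<Longrightarrow> Dom C (Cmp C g f) = Dom C f"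
    and Cod_Cmp: "\<lbrakk>f \<in> Arr C; g \<in> Arr C; Dom C g = Cod C f\<rbrakk> \<Longrightarrow> Cod C (Cmp C g f) = Cod C g"
    and Cmp_Idn: "f \<in> Arr C \<Longrightarrow> Cmp C f (Idn C (Dom C f)) = f"
    and Idn_Cmp: "f \<in> Arr C \<Longrightarrow> Cmp C (Idn C (Cod C f)) f = f"
    and Cmp_assoc: "\<lbrakk>f \<in> Arr C; g \<in> Arr C; h \<in> Arr C; Dom C g = Cod C f; Dom C h = Cod C g\<rbrakk>
      \<Longrightarrow> Cmp C h (Cmp C g f) = Cmp C (Cmp C h g) f"

definition iso_in :: "('o, 'm) cat \<Rightarrow> 'm \<Rightarrow> bool" where
  "iso_in C f \<longleftrightarrow> f \<in> Arr C \<and>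
    (\<exists>g\<in>Arr C. Dom C g = Cod C f \<and> Cod C g = Dom C f \<and>
       Cmp C g f = Idn C (Dom C f) \<and> Cmp C f g = Idn C (Cod C f))"

definition op_cat :: "('o, 'm) cat \<Rightarrow> ('o, 'm) cat" where
  "op_cat C = \<lparr>Obj = Obj C, Arr = Arr C, Dom = Cod C, Cod = Dom C, Idn = Idn C,
     Cmp = (\<lambda>g f. Cmp C f g)\<rparr>"

record ('o1, 'm1, 'o2, 'm2) cfunctor =
  Fobj :: "'o1 \<Rightarrow> 'o2"
  Farr :: "'m1 \<Rightarrow> 'm2"

definition is_functor ::
  "('o1, 'm1) cat \<Rightarrow> ('o2, 'm2) cat \<Rightarrow> ('o1, 'm1, 'o2, 'm2) cfunctor \<Rightarrow> bool" where
  "is_functor C D F \<longleftrightarrow>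
     Fobj F \<in> Obj C \<rightarrow>\<^sub>E Obj D \<and> Farr F \<in> Arr C \<rightarrow>\<^sub>E Arr D \<and>
     (\<forall>f\<in>Arr C. Dom D (Farr F f) = Fobj F (Dom C f) \<and> Cod D (Farr F f) = Fobj F (Cod C f)) \<and>
     (\<forall>c\<in>Obj C. Farr F (Idn C c) = Idn D (Fobj F c)) \<and>
     (\<forall>f\<in>Arr C. \<forall>g\<in>Arr C. Dom C g = Cod C f \<longrightarrow>
        Farr F (Cmp C g f) = Cmp D (Farr F g) (Farr F f))"

definition id_functor :: "('o, 'm) cat \<Rightarrow> ('o, 'm, 'o, 'm) cfunctor" where
  "id_functor C = \<lparr>Fobj = (\<lambda>c\<in>Obj C. c), Farr = (\<lambda>f\<in>Arr C. f)\<rparr>"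

text \<open>\<open>functor_comp C G F\<close> is \<open>G \<circ> F\<close>, where \<open>C\<close> is the domain of \<open>F\<close>.\<close>

definition functor_comp ::
  "('o1, 'm1) cat \<Rightarrow> ('o2, 'm2, 'o3, 'm3) cfunctor \<Rightarrow> ('o1, 'm1, 'o2, 'm2) cfunctor
    \<Rightarrow> ('o1, 'm1, 'o3, 'm3) cfunctor" where
  "functor_comp C G F =
     \<lparr>Fobj = compose (Obj C) (Fobj G) (Fobj F), Farr = compose (Arr C) (Farr G) (Farr F)\<rparr>"

text \<open>The opposite functor \<open>C\<^sup>o\<^sup>p \<rightarrow> D\<^sup>o\<^sup>p\<close> has the same object and arrow maps.\<close>

definition op_functor :: "('o1, 'm1, 'o2, 'm2) cfunctor \<Rightarrow> ('o1, 'm1, 'o2, 'm2) cfunctor" where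
  "op_functor F = F"

definition iso_of_categories ::
  "('o1, 'm1) cat \<Rightarrow> ('o2, 'm2) cat \<Rightarrow> ('o1, 'm1, 'o2, 'm2) cfunctor \<Rightarrow> bool" where
  "iso_of_categories C D F \<longleftrightarrow> is_functor C D F \<and>
     (\<exists>G. is_functor D C G \<and> functor_comp C G F = id_functor C \<and>
          functor_comp D F G = id_functor D)"

definition nat_trans ::
  "('o1, 'm1) cat \<Rightarrow> ('o2, 'm2) cat \<Rightarrow> ('o1, 'm1, 'o2, 'm2) cfunctor
    \<Rightarrow> ('o1, 'm1, 'o2, 'm2) cfunctor \<Rightarrow> ('o1 \<Rightarrow> 'm2) \<Rightarrow> bool" where
  "nat_trans C D F G \<tau> \<longleftrightarrow>
     is_functor C D F \<and> is_functor C D G \<and> \<tau> \<in> Obj C \<rightarrow>\<^sub>E Arr D \<and>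
     (\<forall>c\<in>Obj C. Dom D (\<tau> c) = Fobj F c \<and> Cod D (\<tau> c) = Fobj G c) \<and>
     (\<forall>f\<in>Arr C. Cmp D (Farr G f) (\<tau> (Dom C f)) = Cmp D (\<tau> (Cod C f)) (Farr F f))"

definition nat_iso ::
  "('o1, 'm1) cat \<Rightarrow> ('o2, 'm2) cat \<Rightarrow> ('o1, 'm1, 'o2, 'm2) cfunctor
    \<Rightarrow> ('o1, 'm1, 'o2, 'm2) cfunctor \<Rightarrow> ('o1 \<Rightarrow> 'm2) \<Rightarrow> bool" where
  "nat_iso C D F G \<tau> \<longleftrightarrow> nat_trans C D F G \<tau> \<and> (\<forall>c\<in>Obj C. iso_in D (\<tau> c))"


section \<open>Signed path categories\<close>

definition path_cat :: "('v, 'e) pre_digraph \<Rightarrow> ('v, 'v \<times> 'e list \<times> 'v) cat" where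
  "path_cat G = \<lparr>Obj = verts G, Arr = {(c, p, d). pre_digraph.awalk G c p d},
     Dom = (\<lambda>(c, p, d). c), Cod = (\<lambda>(c, p, d). d), Idn = (\<lambda>c. (c, [], c)),
     Cmp = (\<lambda>(d, q, e) (c, p, d'). (c, p @ q, e))\<rparr>"

text \<open>The smallest congruence on the category \<open>C\<close> containing the relations \<open>R\<close>.\<close>

inductive_set cat_congruence :: "('o, 'm) cat \<Rightarrow> ('m \<times> 'm) set \<Rightarrow> ('m \<times> 'm) set"
  for C :: "('o, 'm) cat" and R :: "('m \<times> 'm) set" where
  base: "\<lbrakk>(f, g) \<in> R; f \<in> Arr C; g \<in> Arr C; Dom C f = Dom C g; Cod C f = Cod C g\<rbrakk>
    \<Longrightarrow> (f, g) \<in> cat_congruence C R"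
| refl: "f \<in> Arr C \<Longrightarrow> (f, f) \<in> cat_congruence C R"
| sym: "(f, g) \<in> cat_congruence C R \<Longrightarrow> (g, f) \<in> cat_congruence C R"
| trans: "\<lbrakk>(f, g) \<in> cat_congruence C R; (g, h) \<in> cat_congruence C R\<rbrakk>
    \<Longrightarrow> (f, h) \<in> cat_congruence C R"
| cmp: "\<lbrakk>(f, f') \<in> cat_congruence C R; (g, g') \<in> cat_congruence C R; Dom C g = Cod C f\<rbrakk>
    \<Longrightarrow> (Cmp C g f, Cmp C g' f') \<in> cat_congruence C R"

definition quotient_cat :: "('o, 'm) cat \<Rightarrow> ('m \<times> 'm) set \<Rightarrow> ('o, 'm set) cat" where
  "quotient_cat C R = \<lparr>Obj = Obj C, Arr = Arr C // cat_congruence C R,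
     Dom = (\<lambda>K. the_elem (Dom C ` K)), Cod = (\<lambda>K. the_elem (Cod C ` K)),
     Idn = (\<lambda>c. cat_congruence C R `` {Idn C c}),
     Cmp = (\<lambda>L K. cat_congruence C R `` {Cmp C g f | g f. g \<in> L \<and> f \<in> K})\<rparr>"

datatype sign = Plus | Minus

type_synonym 'v signed_arc = "('v \<times> 'v) \<times> sign"
type_synonym 'v signed_cat = "('v, ('v \<times> 'v signed_arc list \<times> 'v) set) cat"

text \<open>
  A simple directed graph \<open>E\<close> (possibly infinite) is a \<^locale>\<open>pair_loopfree_digraph\<close>; the signed
  arrows \<open>\<alpha>\<^sup>+\<close> and \<open>\<alpha>\<^sup>-\<close> of \<open>E\<^sub>\<plusminus>\<close> are \<open>(\<alpha>, Plus)\<close> and \<open>(\<alpha>, Minus)\<close>.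
\<close>

definition signed_graph :: "'v pair_pre_digraph \<Rightarrow> ('v, 'v signed_arc) pre_digraph" where
  "signed_graph E =
     \<lparr>verts = pverts E, arcs = parcs E \<times> UNIV, tail = fst \<circ> fst, head = snd \<circ> fst\<rparr>"

definition signed_relations ::
  "'v pair_pre_digraph \<Rightarrow> (('v \<times> 'v signed_arc list \<times> 'v) \<times> ('v \<times> 'v signed_arc list \<times> 'v)) set" where
  "signed_relations E =
     {((c, [((c, d), s), ((d, c), t)], c), (c, [], c)) | c d s t.
        (c, d) \<in> parcs E \<and> (d, c) \<in> parcs E \<and> (s, t) \<in> {(Plus, Minus), (Minus, Plus)}}"

definition signed_path_category :: "'v pair_pre_digraph \<Rightarrow> 'v signed_cat" where
  "signed_path_category E = quotient_cat (path_cat (signed_graph E)) (signed_relations E)"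


section \<open>Sets, abelian groups and free abelian sheaves\<close>

type_synonym 'a set_arrow = "'a set \<times> ('a \<Rightarrow> 'a) \<times> 'a set"

definition Set_cat :: "('a set, 'a set_arrow) cat" where
  "Set_cat = \<lparr>Obj = UNIV, Arr = {(S, f, T). f \<in> S \<rightarrow>\<^sub>E T},
     Dom = (\<lambda>(S, f, T). S), Cod = (\<lambda>(S, f, T). T), Idn = (\<lambda>S. (S, \<lambda>x\<in>S. x, S)),
     Cmp = (\<lambda>(S, g, T) (R, f, S'). (R, compose R g f, T))\<rparr>"

definition ab_hom :: "'a monoid \<Rightarrow> 'b monoid \<Rightarrow> ('a \<Rightarrow> 'b) set" where
  "ab_hom G H = hom G H \<inter> extensional (carrier G)"

type_synonym 'a ab_arrow = "'a monoid \<times> ('a \<Rightarrow> 'a) \<times> 'a monoid"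

definition Ab :: "('a monoid, 'a ab_arrow) cat" where
  "Ab = \<lparr>Obj = {G. comm_group G}, Arr = {(G, h, H). comm_group G \<and> comm_group H \<and> h \<in> ab_hom G H},
     Dom = (\<lambda>(G, h, H). G), Cod = (\<lambda>(G, h, H). H), Idn = (\<lambda>G. (G, \<lambda>x\<in>carrier G. x, G)),
     Cmp = (\<lambda>(H, k, K) (G, h, H'). (G, compose (carrier G) k h, K))\<rparr>"

abbreviation amap :: "'a ab_arrow \<Rightarrow> 'a \<Rightarrow> 'a" where
  "amap u \<equiv> fst (snd u)"

type_synonym ('o, 'm, 'a) ab_functor = "('o, 'm, 'a monoid, 'a ab_arrow) cfunctor"

definition Free :: "('a set, 'a set_arrow, 'a \<Rightarrow>\<^sub>0 int) ab_functor" where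
  "Free = \<lparr>Fobj = free_Abelian_group,
     Farr = (\<lambda>(S, f, T)\<in>Arr Set_cat.
       (free_Abelian_group S,
        \<lambda>x\<in>carrier (free_Abelian_group S). frag_extend (frag_of \<circ> f) x,
        free_Abelian_group T))\<rparr>"

definition free_abelian_sheaf :: "('o, 'm) cat \<Rightarrow> ('o, 'm, 'b \<Rightarrow>\<^sub>0 int) ab_functor \<Rightarrow> bool" where
  "free_abelian_sheaf C F \<longleftrightarrow> (\<exists>B. is_functor C Set_cat B \<and> F = functor_comp C Free B)"

definition dual_group :: "'a monoid \<Rightarrow> ('a \<Rightarrow> int) monoid" where
  "dual_group G = \<lparr>carrier = ab_hom G integer_group,
     monoid.mult = (\<lambda>\<phi> \<psi>. \<lambda>x\<in>carrier G. \<phi> x + \<psi> x), one = (\<lambda>x\<in>carrier G. 0)\<rparr>"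

definition dual_arrow :: "'a ab_arrow \<Rightarrow> ('a \<Rightarrow> int) ab_arrow" where
  "dual_arrow = (\<lambda>(G, h, H).
     (dual_group H, \<lambda>\<phi>\<in>carrier (dual_group H). compose (carrier G) \<phi> h, dual_group G))"

text \<open>For \<open>F : C \<rightarrow> Ab\<close> this is \<open>F\<^sup>* : C\<^sup>o\<^sup>p \<rightarrow> Ab\<close>.\<close>

definition dual_functor :: "('o, 'm) cat \<Rightarrow> ('o, 'm, 'a) ab_functor \<Rightarrow> ('o, 'm, 'a \<Rightarrow> int) ab_functor" where
  "dual_functor C F =
     \<lparr>Fobj = (\<lambda>c\<in>Obj C. dual_group (Fobj F c)), Farr = (\<lambda>f\<in>Arr C. dual_arrow (Farr F f))\<rparr>"


section \<open>Pairings and factorizations\<close>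

definition is_pairing ::
  "('o, 'm) cat \<Rightarrow> ('o, 'm, 'a) ab_functor \<Rightarrow> ('o, 'm, 'b) ab_functor
    \<Rightarrow> ('o \<Rightarrow> 'a \<Rightarrow> 'b \<Rightarrow> int) \<Rightarrow> bool" where
  "is_pairing C F G pr \<longleftrightarrow>
     pr \<in> extensional (Obj C) \<and>
     (\<forall>c\<in>Obj C. pr c \<in> extensional (carrier (Fobj F c)) \<and>
        (\<forall>a\<in>carrier (Fobj F c). pr c a \<in> ab_hom (Fobj G c) integer_group) \<and>
        (\<forall>b\<in>carrier (Fobj G c). (\<lambda>a. pr c a b) \<in> hom (Fobj F c) integer_group)) \<and>
     (\<forall>f\<in>Arr C. \<forall>a\<in>carrier (Fobj F (Dom C f)). \<forall>b\<in>carrier (Fobj G (Cod C f)).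
        pr (Dom C f) a (amap (Farr G f) b) = pr (Cod C f) (amap (Farr F f) a) b)"

definition delta ::
  "('o, 'm, 'a) ab_functor \<Rightarrow> ('o, 'm, 'b) ab_functor \<Rightarrow> ('o \<Rightarrow> 'a \<Rightarrow> 'b \<Rightarrow> int)
    \<Rightarrow> 'o \<Rightarrow> 'b \<Rightarrow> 'a \<Rightarrow> int" where
  "delta F G pr c = (\<lambda>b\<in>carrier (Fobj G c). \<lambda>a\<in>carrier (Fobj F c). pr c a b)"

definition right_nondegenerate ::
  "('o, 'm) cat \<Rightarrow> ('o, 'm, 'a) ab_functor \<Rightarrow> ('o, 'm, 'b) ab_functor
    \<Rightarrow> ('o \<Rightarrow> 'a \<Rightarrow> 'b \<Rightarrow> int) \<Rightarrow> bool" where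
  "right_nondegenerate C F G pr \<longleftrightarrow>
     (\<forall>c\<in>Obj C. inj_on (delta F G pr c) (carrier (Fobj G c)))"

text \<open>A factorization \<open>P \<rightarrow> Q\<close> from a contravariant to a covariant functor on \<open>C\<close>.\<close>

definition factorization_contra_co ::
  "('o, 'm) cat \<Rightarrow> ('o, 'm, 'a) ab_functor \<Rightarrow> ('o, 'm, 'b) ab_functor
    \<Rightarrow> ('o \<Rightarrow> 'a \<Rightarrow> 'b) \<Rightarrow> bool" where
  "factorization_contra_co C P Q \<theta> \<longleftrightarrow>
     is_functor (op_cat C) Ab P \<and> is_functor C Ab Q \<and> \<theta> \<in> extensional (Obj C) \<and>
     (\<forall>c\<in>Obj C. \<theta> c \<in> ab_hom (Fobj P c) (Fobj Q c)) \<and>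
     (\<forall>f\<in>Arr C. \<forall>x\<in>carrier (Fobj P (Cod C f)).
        \<theta> (Cod C f) x = amap (Farr Q f) (\<theta> (Dom C f) (amap (Farr P f) x)))"

text \<open>A factorization \<open>Q \<rightarrow> P\<close> from a covariant to a contravariant functor on \<open>C\<close>.\<close>

definition factorization_co_contra ::
  "('o, 'm) cat \<Rightarrow> ('o, 'm, 'a) ab_functor \<Rightarrow> ('o, 'm, 'b) ab_functor
    \<Rightarrow> ('o \<Rightarrow> 'a \<Rightarrow> 'b) \<Rightarrow> bool" where
  "factorization_co_contra C Q P \<theta> \<longleftrightarrow>
     is_functor C Ab Q \<and> is_functor (op_cat C) Ab P \<and> \<theta> \<in> extensional (Obj C) \<and>
     (\<forall>c\<in>Obj C. \<theta> c \<in> ab_hom (Fobj Q c) (Fobj P c)) \<and>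
     (\<forall>f\<in>Arr C. \<forall>x\<in>carrier (Fobj Q (Dom C f)).
        \<theta> (Dom C f) x = amap (Farr P f) (\<theta> (Cod C f) (amap (Farr Q f) x)))"


section \<open>Abstract (quantum) cluster structures\<close>

text \<open>
  The type variables \<open>'v\<close>, \<open>'x\<close>, \<open>'a\<close> bound the vertex sets and the bases of the values of the two
  free abelian sheaves.
\<close>

record ('v, 'x, 'a) acs =
  base :: "'v signed_cat"
  Xs :: "('v, ('v \<times> 'v signed_arc list \<times> 'v) set, 'x \<Rightarrow>\<^sub>0 int) ab_functor"
  fct :: "'v \<Rightarrow> ('x \<Rightarrow>\<^sub>0 int) \<Rightarrow> ('a \<Rightarrow>\<^sub>0 int)"  \<comment> \<open>the factorization \<open>\<beta>\<close>\<close>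
  As :: "('v, ('v \<times> 'v signed_arc list \<times> 'v) set, 'a \<Rightarrow>\<^sub>0 int) ab_functor"
  pairing :: "'v \<Rightarrow> ('a \<Rightarrow>\<^sub>0 int) \<Rightarrow> ('x \<Rightarrow>\<^sub>0 int) \<Rightarrow> int"

record ('v, 'x, 'a) aqcs = "('v, 'x, 'a) acs" +
  qfct :: "'v \<Rightarrow> ('a \<Rightarrow>\<^sub>0 int) \<Rightarrow> (('a \<Rightarrow>\<^sub>0 int) \<Rightarrow> int)"  \<comment> \<open>the factorization \<open>\<lambda>\<close>\<close>

definition is_acs :: "('v, 'x, 'a, 'z) acs_scheme \<Rightarrow> bool" where
  "is_acs S \<longleftrightarrow>
     (\<exists>E. pair_loopfree_digraph E \<and> base S = signed_path_category E) \<and>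
     free_abelian_sheaf (op_cat (base S)) (Xs S) \<and>
     free_abelian_sheaf (base S) (As S) \<and>
     factorization_contra_co (base S) (Xs S) (As S) (fct S) \<and>
     is_pairing (base S) (As S) (Xs S) (pairing S) \<and>
     right_nondegenerate (base S) (As S) (Xs S) (pairing S)"

definition is_aqcs :: "('v, 'x, 'a) aqcs \<Rightarrow> bool" where
  "is_aqcs S \<longleftrightarrow> is_acs S \<and>
     factorization_co_contra (base S) (As S) (dual_functor (base S) (As S)) (qfct S) \<and>
     (\<exists>\<rho>. factorization_co_contra (base S) (As S) (Xs S) \<rho> \<and>
        (\<forall>c\<in>Obj (base S). \<forall>x\<in>carrier (Fobj (Xs S) c). \<rho> c (fct S c x) = x) \<and>
        (\<forall>c\<in>Obj (base S). \<forall>a\<in>carrier (Fobj (As S) c).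
           qfct S c a = delta (As S) (Xs S) (pairing S) c (\<rho> c a)))"

text \<open>
  A morphism carries its source and target; the type variable \<open>'s\<close> is instantiated with the type of
  abstract cluster structures or of abstract quantum cluster structures.
\<close>

record ('v, 'x, 'a, 's) cs_mor =
  src :: 's
  tgt :: 's
  mfun :: "('v, ('v \<times> 'v signed_arc list \<times> 'v) set, 'v, ('v \<times> 'v signed_arc list \<times> 'v) set) cfunctor"
  chi :: "'v \<Rightarrow> ('x \<Rightarrow>\<^sub>0 int) ab_arrow"
  alpha :: "'v \<Rightarrow> ('a \<Rightarrow>\<^sub>0 int) ab_arrow"

definition is_acs_mor :: "('v, 'x, 'a, ('v, 'x, 'a, 'z) acs_scheme) cs_mor \<Rightarrow> bool" where
  "is_acs_mor m \<longleftrightarrow>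
     is_acs (src m) \<and> is_acs (tgt m) \<and>
     is_functor (base (src m)) (base (tgt m)) (mfun m) \<and>
     nat_trans (op_cat (base (src m))) Ab
       (Xs (src m)) (functor_comp (op_cat (base (src m))) (Xs (tgt m)) (op_functor (mfun m))) (chi m) \<and>
     nat_trans (base (src m)) Ab
       (As (src m)) (functor_comp (base (src m)) (As (tgt m)) (mfun m)) (alpha m) \<and>
     (\<forall>c\<in>Obj (base (src m)). \<forall>x\<in>carrier (Fobj (Xs (src m)) c).
        amap (alpha m c) (fct (src m) c x) = fct (tgt m) (Fobj (mfun m) c) (amap (chi m c) x))"

definition is_aqcs_mor :: "('v, 'x, 'a, ('v, 'x, 'a) aqcs) cs_mor \<Rightarrow> bool" where
  "is_aqcs_mor m \<longleftrightarrow> is_acs_mor m \<and> is_aqcs (src m) \<and> is_aqcs (tgt m) \<and>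
     (\<forall>c\<in>Obj (base (src m)). \<forall>a\<in>carrier (Fobj (As (src m)) c).
        qfct (src m) c a =
          amap (dual_arrow (alpha m c)) (qfct (tgt m) (Fobj (mfun m) c) (amap (alpha m c) a)))"

definition cs_id :: "('v, 'x, 'a, 'z) acs_scheme \<Rightarrow> ('v, 'x, 'a, ('v, 'x, 'a, 'z) acs_scheme) cs_mor" where
  "cs_id S = \<lparr>src = S, tgt = S, mfun = id_functor (base S),
     chi = (\<lambda>c\<in>Obj (base S). Idn Ab (Fobj (Xs S) c)),
     alpha = (\<lambda>c\<in>Obj (base S). Idn Ab (Fobj (As S) c))\<rparr>"

definition cs_comp ::
  "('v, 'x, 'a, ('v, 'x, 'a, 'z) acs_scheme) cs_mor \<Rightarrow> ('v, 'x, 'a, ('v, 'x, 'a, 'z) acs_scheme) cs_mor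
    \<Rightarrow> ('v, 'x, 'a, ('v, 'x, 'a, 'z) acs_scheme) cs_mor" where
  "cs_comp n m = \<lparr>src = src m, tgt = tgt n, mfun = functor_comp (base (src m)) (mfun n) (mfun m),
     chi = (\<lambda>c\<in>Obj (base (src m)). Cmp Ab (chi n (Fobj (mfun m) c)) (chi m c)),
     alpha = (\<lambda>c\<in>Obj (base (src m)). Cmp Ab (alpha n (Fobj (mfun m) c)) (alpha m c))\<rparr>"

definition ACS :: "(('v, 'x, 'a) acs, ('v, 'x, 'a, ('v, 'x, 'a) acs) cs_mor) cat" where
  "ACS = \<lparr>Obj = {S. is_acs S}, Arr = {m. is_acs_mor m}, Dom = src, Cod = tgt, Idn = cs_id, Cmp = cs_comp\<rparr>"

definition AQCS :: "(('v, 'x, 'a) aqcs, ('v, 'x, 'a, ('v, 'x, 'a) aqcs) cs_mor) cat" where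
  "AQCS = \<lparr>Obj = {S. is_aqcs S}, Arr = {m. is_aqcs_mor m}, Dom = src, Cod = tgt, Idn = cs_id, Cmp = cs_comp\<rparr>"

end

theory Submission
  imports Defs
begin

text \<open>
  An inverse in the category of cluster structures consists of an inverse functor \<open>G\<close> of \<open>F\<close>
  together with families inverse to \<open>\<chi>\<close> and \<open>\<alpha>\<close>, so the forward direction only has to evaluate the
  two composites at \<open>c\<close> and at \<open>F c\<close>. Conversely, \<open>d \<mapsto> (\<tau>\<^bsub>G d\<^esub>)\<^sup>-\<^sup>1\<close> is natural whenever \<open>\<tau>\<close> is a
  natural isomorphism, and conditions (p) and (q) for the inverse follow by cancelling the
  isomorphisms in the conditions at \<open>G d\<close>.
\<close>

section \<open>Categories and functors\<close>

lemma op_cat_simps [simp]: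
  "Obj (op_cat C) = Obj C" "Arr (op_cat C) = Arr C" "Dom (op_cat C) = Cod C" "Cod (op_cat C) = Dom C"
  "Idn (op_cat C) = Idn C" "Cmp (op_cat C) g f = Cmp C f g"
  by (simp_all add: op_cat_def)

lemma (in category) category_op_cat: "category (op_cat C)"
  by unfold_locales
    (simp_all add: Dom_in Cod_in Idn_in Dom_Idn Cod_Idn Cmp_in Dom_Cmp Cod_Cmp Cmp_Idn Idn_Cmp Cmp_assoc)

lemma functor_comp_op_cat [simp]: "functor_comp (op_cat C) G F = functor_comp C G F"
  by (simp add: functor_comp_def)

lemma id_functor_op_cat [simp]: "id_functor (op_cat C) = id_functor C"
  by (simp add: id_functor_def)

lemma is_functor_op_cat:
  assumes "is_functor C D F"
  shows "is_functor (op_cat C) (op_cat D) F"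
  using assms by (simp add: is_functor_def)

lemma is_functorD:
  assumes "is_functor C D F"
  shows "c \<in> Obj C \<Longrightarrow> Fobj F c \<in> Obj D"
    and "f \<in> Arr C \<Longrightarrow> Farr F f \<in> Arr D"
    and "f \<in> Arr C \<Longrightarrow> Dom D (Farr F f) = Fobj F (Dom C f)"
    and "f \<in> Arr C \<Longrightarrow> Cod D (Farr F f) = Fobj F (Cod C f)"
    and "c \<in> Obj C \<Longrightarrow> Farr F (Idn C c) = Idn D (Fobj F c)"
    and "\<lbrakk>f \<in> Arr C; g \<in> Arr C; Dom C g = Cod C f\<rbrakk>
      \<Longrightarrow> Farr F (Cmp C g f) = Cmp D (Farr F g) (Farr F f)"
  using assms by (auto simp: is_functor_def)

lemma functor_comp_apply:
  "c \<in> Obj C \<Longrightarrow> Fobj (functor_comp C G F) c = Fobj G (Fobj F c)"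
  "f \<in> Arr C \<Longrightarrow> Farr (functor_comp C G F) f = Farr G (Farr F f)"
  by (simp_all add: functor_comp_def compose_def)

lemma (in category) is_functor_comp:
  assumes F: "is_functor C D F" and G: "is_functor D E G"
  shows "is_functor C E (functor_comp C G F)"
  unfolding is_functor_def
proof (intro conjI ballI impI)
  show "Fobj (functor_comp C G F) \<in> Obj C \<rightarrow>\<^sub>E Obj E" "Farr (functor_comp C G F) \<in> Arr C \<rightarrow>\<^sub>E Arr E"
    using is_functorD[OF F] is_functorD[OF G] by (auto simp: functor_comp_def compose_def)
qed (simp_all add: functor_comp_apply Dom_in Cod_in Idn_in Cmp_in is_functorD[OF F] is_functorD[OF G])

lemma functor_comp_id_apply:
  assumes "functor_comp C G F = id_functor C"
  shows "c \<in> Obj C \<Longrightarrow> Fobj G (Fobj F c) = c" "f \<in> Arr C \<Longrightarrow> Farr G (Farr F f) = f"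
  using functor_comp_apply[of _ C G F] unfolding assms by (simp_all add: id_functor_def)

section \<open>Inverting natural transformations along an isomorphism of categories\<close>

lemma nat_transD:
  assumes "nat_trans C D F G \<tau>"
  shows "c \<in> Obj C \<Longrightarrow> \<tau> c \<in> Arr D"
    and "c \<in> Obj C \<Longrightarrow> Dom D (\<tau> c) = Fobj F c"
    and "c \<in> Obj C \<Longrightarrow> Cod D (\<tau> c) = Fobj G c"
    and "f \<in> Arr C \<Longrightarrow> Cmp D (Farr G f) (\<tau> (Dom C f)) = Cmp D (\<tau> (Cod C f)) (Farr F f)"
  using assms by (auto simp: nat_trans_def)

text \<open>The inverse of \<open>\<tau> c\<close> is \<open>\<sigma> (Fobj F c)\<close>. The second
  family of equations, taken at \<open>d = Fobj F c\<close>, concerns \<open>\<tau> c\<close> again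
  because \<open>G\<close> undoes \<open>F\<close>, so this inverse is two-sided. General source
  categories let the result serve the covariant sheaf and, over opposites, the contravariant
  one.\<close>

lemma nat_isoI_inverse:
  assumes F: "is_functor C D F" and GF: "functor_comp C G F = id_functor C"
    and \<tau>: "nat_trans C B P (functor_comp C Q F) \<tau>"
    and \<sigma>: "nat_trans D B Q (functor_comp D P G) \<sigma>"
    and \<sigma>\<tau>: "\<And>c. c \<in> Obj C \<Longrightarrow> Cmp B (\<sigma> (Fobj F c)) (\<tau> c) = Idn B (Fobj P c)"
    and \<tau>\<sigma>: "\<And>d. d \<in> Obj D \<Longrightarrow> Cmp B (\<tau> (Fobj G d)) (\<sigma> d) = Idn B (Fobj Q d)"
  shows "nat_iso C B P (functor_comp C Q F) \<tau>"
  unfolding nat_iso_def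
proof (intro conjI ballI)
  fix c assume c: "c \<in> Obj C"
  note Fc = is_functorD(1)[OF F c] and GFc = functor_comp_id_apply(1)[OF GF c]
  show "iso_in B (\<tau> c)"
    unfolding iso_in_def using \<sigma>\<tau>[OF c] \<tau>\<sigma>[OF Fc]
    by (intro conjI bexI[of _ "\<sigma> (Fobj F c)"])
      (simp_all add: c Fc GFc functor_comp_apply nat_transD[OF \<tau>] nat_transD[OF \<sigma>])
qed (fact \<tau>)

text \<open>Naturality of the inverse family at \<open>f\<close> comes from the square of
  \<open>\<tau>\<close> at \<open>Farr G f\<close>, whose \<open>Q\<close>-side is
  \<open>Farr Q f\<close> since \<open>F\<close> undoes \<open>G\<close>. The two composite
  equations have exactly the shape needed for a two-sided inverse in the category of cluster
  structures.\<close>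

lemma nat_iso_inverse:
  assumes "category C" and "category D" and "category B"
    and F: "is_functor C D F" and G: "is_functor D C G"
    and GF: "functor_comp C G F = id_functor C" and FG: "functor_comp D F G = id_functor D"
    and Q: "is_functor D B Q"
    and \<tau>: "nat_iso C B P (functor_comp C Q F) \<tau>"
  obtains \<sigma> where "nat_trans D B Q (functor_comp D P G) \<sigma>"
    and "\<And>c. c \<in> Obj C \<Longrightarrow> Cmp B (\<sigma> (Fobj F c)) (\<tau> c) = Idn B (Fobj P c)"
    and "\<And>d. d \<in> Obj D \<Longrightarrow> Cmp B (\<tau> (Fobj G d)) (\<sigma> d) = Idn B (Fobj Q d)"
proof -
  interpret C: category C by fact
  interpret D: category D by fact
  interpret B: category B by fact
  have nt: "nat_trans C B P (functor_comp C Q F) \<tau>" using \<tau> by (simp add: nat_iso_def)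
  have P: "is_functor C B P" using nt by (simp add: nat_trans_def)
  note fs = is_functorD[OF F] is_functorD[OF G] is_functorD[OF P] is_functorD[OF Q]
  note GFs = functor_comp_id_apply[OF GF] and FGs = functor_comp_id_apply[OF FG]
  have "\<exists>s. s \<in> Arr B \<and> Dom B s = Cod B (\<tau> c) \<and> Cod B s = Dom B (\<tau> c) \<and>
      Cmp B s (\<tau> c) = Idn B (Dom B (\<tau> c)) \<and> Cmp B (\<tau> c) s = Idn B (Cod B (\<tau> c))"
    if "c \<in> Obj C" for c
    using \<tau> that by (auto simp: nat_iso_def iso_in_def)
  then obtain i where i: "\<And>c. c \<in> Obj C \<Longrightarrow> i c \<in> Arr B \<and> Dom B (i c) = Cod B (\<tau> c) \<and>
      Cod B (i c) = Dom B (\<tau> c) \<and> Cmp B (i c) (\<tau> c) = Idn B (Dom B (\<tau> c)) \<and>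
      Cmp B (\<tau> c) (i c) = Idn B (Cod B (\<tau> c))"
    by metis
  \<comment> \<open>The restriction to \<open>Obj D\<close> makes the family extensional, as
    \<open>nat_trans\<close> demands.\<close>
  define \<sigma> where "\<sigma> = (\<lambda>d\<in>Obj D. i (Fobj G d))"
  have s: "\<sigma> d \<in> Arr B" "Dom B (\<sigma> d) = Fobj Q d" "Cod B (\<sigma> d) = Fobj P (Fobj G d)"
    "Cmp B (\<tau> (Fobj G d)) (\<sigma> d) = Idn B (Fobj Q d)"
    "Cmp B (\<sigma> d) (\<tau> (Fobj G d)) = Idn B (Fobj P (Fobj G d))"
    if d: "d \<in> Obj D" for d
    using i[of "Fobj G d"] d
    by (simp_all add: \<sigma>_def fs(7) nat_transD[OF nt] functor_comp_apply FGs)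
  have "Cmp B (Farr (functor_comp D P G) f) (\<sigma> (Dom D f)) = Cmp B (\<sigma> (Cod D f)) (Farr Q f)"
    if f: "f \<in> Arr D" for f
  proof -
    define a b where "a = Dom D f" and "b = Cod D f"
    have ab: "a \<in> Obj D" "b \<in> Obj D" using f D.Dom_in D.Cod_in by (simp_all add: a_def b_def)
    define p q where "p = Farr P (Farr G f)" and "q = Farr Q f"
    have p: "p \<in> Arr B" "Dom B p = Fobj P (Fobj G a)" "Cod B p = Fobj P (Fobj G b)"
      and q: "q \<in> Arr B" "Dom B q = Fobj Q a" "Cod B q = Fobj Q b"
      using f by (simp_all add: p_def q_def a_def b_def fs)
    have t: "\<tau> (Fobj G x) \<in> Arr B" "Dom B (\<tau> (Fobj G x)) = Fobj P (Fobj G x)"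
      "Cod B (\<tau> (Fobj G x)) = Fobj Q x" if "x \<in> Obj D" for x
      using that by (simp_all add: fs nat_transD[OF nt] functor_comp_apply FGs)
    have nat: "Cmp B q (\<tau> (Fobj G a)) = Cmp B (\<tau> (Fobj G b)) p"
      using nat_transD(4)[OF nt, of "Farr G f"] f
      by (simp add: functor_comp_apply fs FGs p_def q_def a_def b_def)
    \<comment> \<open>An identity is inserted on the left so that it can be split as
      \<open>\<sigma> b\<close> after \<open>\<tau> (Fobj G b)\<close>; the latter then meets
      \<open>p\<close>, where \<open>nat\<close> applies.\<close>
    have "Cmp B p (\<sigma> a) = Cmp B (Idn B (Cod B p)) (Cmp B p (\<sigma> a))"
      using B.Idn_Cmp[of "Cmp B p (\<sigma> a)"] p s[OF ab(1)] by (simp add: B.Cmp_in B.Cod_Cmp)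
    also have "\<dots> = Cmp B (Cmp B (\<sigma> b) (\<tau> (Fobj G b))) (Cmp B p (\<sigma> a))"
      using s[OF ab(2)] p by simp
    also have "\<dots> = Cmp B (\<sigma> b) (Cmp B (\<tau> (Fobj G b)) (Cmp B p (\<sigma> a)))"
      using s(1-3)[OF ab(1)] s(1-3)[OF ab(2)] t[OF ab(2)] p
      by (intro B.Cmp_assoc[symmetric]) (simp_all add: B.Cmp_in B.Cod_Cmp)
    \<comment> \<open>From here only the factor to the right of \<open>\<sigma> b\<close> is
      rewritten, by substitution; it reduces to \<open>q\<close>, so the chain ends in
      \<open>Cmp B (\<sigma> b) q\<close>.\<close>
    also have "Cmp B (\<tau> (Fobj G b)) (Cmp B p (\<sigma> a)) = Cmp B (Cmp B (\<tau> (Fobj G b)) p) (\<sigma> a)"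
      using s(1-3)[OF ab(1)] t[OF ab(2)] p by (intro B.Cmp_assoc) simp_all
    also have "\<dots> = Cmp B q (Cmp B (\<tau> (Fobj G a)) (\<sigma> a))"
      using s(1-3)[OF ab(1)] t[OF ab(1)] q by (simp add: nat[symmetric] B.Cmp_assoc)
    also have "\<dots> = q"
      using s[OF ab(1)] q B.Cmp_Idn[of q] by simp
    finally show ?thesis using f by (simp add: p_def q_def a_def b_def functor_comp_apply)
  qed
  moreover have "\<sigma> \<in> Obj D \<rightarrow>\<^sub>E Arr B" using s(1) by (auto simp: \<sigma>_def)
  ultimately have "nat_trans D B Q (functor_comp D P G) \<sigma>"
    unfolding nat_trans_def using Q D.is_functor_comp[OF G P] s by (simp add: functor_comp_apply)
  moreover have "Cmp B (\<sigma> (Fobj F c)) (\<tau> c) = Idn B (Fobj P c)" if "c \<in> Obj C" for c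
    using s(5)[of "Fobj F c"] that by (simp add: fs GFs)
  ultimately show thesis using that s(4) by blast
qed

section \<open>Signed path categories and the category of abelian groups\<close>

text \<open>Only parallel arrows are ever identified, since the generating rule requires equal
  endpoints and composition preserves this. Domain and codomain are therefore well defined on
  classes.\<close>

lemma (in category) cat_congruenceD:
  assumes "(f, g) \<in> cat_congruence C R"
  shows "f \<in> Arr C \<and> g \<in> Arr C \<and> Dom C f = Dom C g \<and> Cod C f = Cod C g"
  using assms
  by induction (auto simp: Cmp_in Dom_Cmp Cod_Cmp)

text \<open>The quotient operations can be computed on representatives: the image of a class under
  \<open>Dom\<close> or \<open>Cod\<close> is a singleton, and composites of equivalent arrows are
  equivalent.\<close>

lemma (in category) quotient_cat_simps:
  assumes "f \<in> Arr C"
  shows "Dom (quotient_cat C R) (cat_congruence C R `` {f}) = Dom C f"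
    and "Cod (quotient_cat C R) (cat_congruence C R `` {f}) = Cod C f"
    and "\<lbrakk>g \<in> Arr C; Dom C g = Cod C f\<rbrakk> \<Longrightarrow>
      Cmp (quotient_cat C R) (cat_congruence C R `` {g}) (cat_congruence C R `` {f})
        = cat_congruence C R `` {Cmp C g f}"
proof -
  let ?r = "cat_congruence C R"
  have "Dom C ` (?r `` {f}) = {Dom C f}" "Cod C ` (?r `` {f}) = {Cod C f}"
    using cat_congruence.refl[OF assms] by (auto dest: cat_congruenceD simp: image_iff)
  then show "Dom (quotient_cat C R) (?r `` {f}) = Dom C f"
    "Cod (quotient_cat C R) (?r `` {f}) = Cod C f"
    by (simp_all add: quotient_cat_def)
  assume g: "g \<in> Arr C" "Dom C g = Cod C f"
  have "?r `` {Cmp C g' f' | g' f'. g' \<in> ?r `` {g} \<and> f' \<in> ?r `` {f}} = ?r `` {Cmp C g f}"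
    (is "?r `` ?S = _")
  proof
    \<comment> \<open>By reflexivity \<open>g\<close> and \<open>f\<close> lie in their own classes,
      so their composite is one of the elements of \<open>?S\<close>.\<close>
    show "?r `` {Cmp C g f} \<subseteq> ?r `` ?S"
      using cat_congruence.refl[OF assms] cat_congruence.refl[OF g(1)]
      by (intro Image_mono subset_refl) auto
    show "?r `` ?S \<subseteq> ?r `` {Cmp C g f}"
      by (auto intro: cat_congruence.trans[OF cat_congruence.cmp[OF _ _ g(2)]])
  qed
  then show "Cmp (quotient_cat C R) (?r `` {g}) (?r `` {f}) = ?r `` {Cmp C g f}"
    by (simp add: quotient_cat_def)
qed

text \<open>Every arrow of the quotient is the class of some arrow of \<open>C\<close>, so each law
  reduces to the same law for representatives.\<close>

lemma (in category) category_quotient_cat: "category (quotient_cat C R)"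
proof -
  let ?r = "cat_congruence C R" and ?Q = "quotient_cat C R"
  have arr: "K \<in> Arr ?Q \<longleftrightarrow> (\<exists>f\<in>Arr C. K = ?r `` {f})" for K
    by (auto simp: quotient_cat_def quotient_def)
  have [simp]: "Obj ?Q = Obj C" "Idn ?Q c = ?r `` {Idn C c}" for c
    by (simp_all add: quotient_cat_def)
  show ?thesis
    by unfold_locales
      (auto simp: arr quotient_cat_simps Dom_in Cod_in Idn_in Dom_Idn Cod_Idn Cmp_in Dom_Cmp Cod_Cmp
        Cmp_Idn Idn_Cmp Cmp_assoc)
qed

lemma (in wf_digraph) category_path_cat: "category (path_cat G)"
  by unfold_locales (auto simp: path_cat_def awalk_Nil_iff intro: awalk_appendI)

lemma (in pair_wf_digraph) category_signed_path_category: "category (signed_path_category G)"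
proof -
  interpret S: wf_digraph "signed_graph G"
    by unfold_locales (auto simp: signed_graph_def in_arcsD1 in_arcsD2)
  interpret P: category "path_cat (signed_graph G)" by (rule S.category_path_cat)
  show ?thesis unfolding signed_path_category_def by (rule P.category_quotient_cat)
qed

text \<open>The category laws are not part of \<open>is_acs\<close>; they hold because the base is a
  quotient of a path category.\<close>

lemma category_base:
  assumes "is_acs S"
  shows "category (base S)"
proof -
  obtain E where "pair_loopfree_digraph E" and S: "base S = signed_path_category E"
    using assms by (auto simp: is_acs_def)
  then interpret pair_loopfree_digraph E by simp
  show ?thesis unfolding S by (rule category_signed_path_category)
qed

lemma category_Ab: "category Ab"
proof
  fix f g h :: "'a ab_arrow"
  assume "f \<in> Arr Ab" "g \<in> Arr Ab" "h \<in> Arr Ab" "Dom Ab g = Cod Ab f" "Dom Ab h = Cod Ab g"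
  then show "Cmp Ab h (Cmp Ab g f) = Cmp Ab (Cmp Ab h g) f"
    \<comment> \<open>Associativity is handled apart as an instance of \<open>compose_assoc\<close>;
      the remaining laws are checked pointwise.\<close>
    by (auto simp: Ab_def ab_hom_def hom_def intro!: compose_assoc)
qed (auto simp: Ab_def ab_hom_def hom_def compose_def comm_group_def comm_monoid_def
    extensional_def fun_eq_iff monoid.m_closed group_def restrict_def Pi_iff)

section \<open>Arrows of \<open>Ab\<close> and their duals on elements\<close>

lemma amap_closed:
  assumes "u \<in> Arr Ab"
  shows "x \<in> carrier (Dom Ab u) \<Longrightarrow> amap u x \<in> carrier (Cod Ab u)"
  using assms by (auto simp: Ab_def ab_hom_def hom_def)

text \<open>A one-sided arrow equation in \<open>Ab\<close> is enough to cancel on elements of the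
  carrier; every later cancellation has this form.\<close>

lemma amap_inverse:
  assumes "Cmp Ab v u = Idn Ab (Dom Ab u)" and "x \<in> carrier (Dom Ab u)"
  shows "amap v (amap u x) = x"
  using assms by (cases u; cases v) (auto simp: Ab_def compose_def fun_eq_iff restrict_def split: if_splits)

text \<open>The dual map is \<open>undefined\<close> off the dual group of the codomain, so \<phi>
  must be known to lie there before precomposition can be evaluated.\<close>

lemma amap_dual_arrow:
  assumes "\<phi> \<in> ab_hom (Cod Ab u) integer_group"
  shows "amap (dual_arrow u) \<phi> = (\<lambda>x\<in>carrier (Dom Ab u). \<phi> (amap u x))"
  using assms by (cases u) (auto simp: dual_arrow_def dual_group_def Ab_def compose_def)

section \<open>Isomorphisms of cluster structures\<close>

lemma is_acs_morD:
  assumes "is_acs_mor m"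
  shows "is_acs (src m)" "is_acs (tgt m)"
    and "is_functor (base (src m)) (base (tgt m)) (mfun m)"
    and "nat_trans (op_cat (base (src m))) Ab (Xs (src m))
      (functor_comp (op_cat (base (src m))) (Xs (tgt m)) (mfun m)) (chi m)"
    and "nat_trans (base (src m)) Ab (As (src m))
      (functor_comp (base (src m)) (As (tgt m)) (mfun m)) (alpha m)"
    and "\<lbrakk>c \<in> Obj (base (src m)); x \<in> carrier (Fobj (Xs (src m)) c)\<rbrakk>
      \<Longrightarrow> amap (alpha m c) (fct (src m) c x) = fct (tgt m) (Fobj (mfun m) c) (amap (chi m c) x)"
  using assms by (simp_all add: is_acs_mor_def op_functor_def)

lemma is_acsD:
  assumes "is_acs S"
  shows "is_functor (op_cat (base S)) Ab (Xs S)" "is_functor (base S) Ab (As S)"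
    and "\<lbrakk>c \<in> Obj (base S); x \<in> carrier (Fobj (Xs S) c)\<rbrakk> \<Longrightarrow> fct S c x \<in> carrier (Fobj (As S) c)"
  using assms by (auto simp: is_acs_def factorization_contra_co_def ab_hom_def hom_def)

text \<open>Stated over \<open>acs_scheme\<close> to serve both kinds of structure: for a morphism
  of either category, \<open>iso_in\<close> asks for such an \<open>n\<close> among the arrows of
  that category.\<close>

definition mutually_inverse ::
  "('v, 'x, 'a, ('v, 'x, 'a, 'z) acs_scheme) cs_mor \<Rightarrow> ('v, 'x, 'a, ('v, 'x, 'a, 'z) acs_scheme) cs_mor
    \<Rightarrow> bool" where
  "mutually_inverse m n \<longleftrightarrow> src n = tgt m \<and> tgt n = src m \<and>
     cs_comp n m = cs_id (src m) \<and> cs_comp m n = cs_id (tgt m)"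

definition componentwise_iso :: "('v, 'x, 'a, ('v, 'x, 'a, 'z) acs_scheme) cs_mor \<Rightarrow> bool" where
  "componentwise_iso m \<longleftrightarrow>
     iso_of_categories (base (src m)) (base (tgt m)) (mfun m) \<and>
     nat_iso (op_cat (base (src m))) Ab (Xs (src m))
       (functor_comp (op_cat (base (src m))) (Xs (tgt m)) (op_functor (mfun m))) (chi m) \<and>
     nat_iso (base (src m)) Ab (As (src m))
       (functor_comp (base (src m)) (As (tgt m)) (mfun m)) (alpha m)"

lemma mutually_inverse_sym: "mutually_inverse m n \<Longrightarrow> mutually_inverse n m"
  by (simp add: mutually_inverse_def)

lemma mutually_inverseD:
  assumes "mutually_inverse m n"
  shows "src n = tgt m" "tgt n = src m"
    and "functor_comp (base (src m)) (mfun n) (mfun m) = id_functor (base (src m))"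
    and "c \<in> Obj (base (src m)) \<Longrightarrow>
      Cmp Ab (chi n (Fobj (mfun m) c)) (chi m c) = Idn Ab (Fobj (Xs (src m)) c)"
    and "c \<in> Obj (base (src m)) \<Longrightarrow>
      Cmp Ab (alpha n (Fobj (mfun m) c)) (alpha m c) = Idn Ab (Fobj (As (src m)) c)"
proof -
  show "src n = tgt m" "tgt n = src m" using assms by (simp_all add: mutually_inverse_def)
  have "cs_comp n m = cs_id (src m)" using assms by (simp add: mutually_inverse_def)
  then have "mfun (cs_comp n m) = mfun (cs_id (src m))" "chi (cs_comp n m) c = chi (cs_id (src m)) c"
    "alpha (cs_comp n m) c = alpha (cs_id (src m)) c" by simp_all
  then show "functor_comp (base (src m)) (mfun n) (mfun m) = id_functor (base (src m))"
    "c \<in> Obj (base (src m)) \<Longrightarrow>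
      Cmp Ab (chi n (Fobj (mfun m) c)) (chi m c) = Idn Ab (Fobj (Xs (src m)) c)"
    "c \<in> Obj (base (src m)) \<Longrightarrow>
      Cmp Ab (alpha n (Fobj (mfun m) c)) (alpha m c) = Idn Ab (Fobj (As (src m)) c)"
    by (simp_all add: cs_comp_def cs_id_def)
qed

text \<open>The inverse only has to satisfy \<open>is_acs_mor\<close>, which makes this direction
  common to both categories. The sheaf \<open>Xs\<close> is treated over the opposite bases.\<close>

lemma componentwise_isoI:
  assumes m: "is_acs_mor m" and n: "is_acs_mor n" and mn: "mutually_inverse m n"
  shows "componentwise_iso m"
proof -
  note inv = mutually_inverseD[OF mn] mutually_inverseD(3-)[OF mutually_inverse_sym[OF mn]]
  note F = is_acs_morD(3)[OF m] and G = is_acs_morD(3)[OF n]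
  have "iso_of_categories (base (src m)) (base (tgt m)) (mfun m)"
    unfolding iso_of_categories_def using F G inv by auto
  moreover have "nat_iso (op_cat (base (src m))) Ab (Xs (src m))
       (functor_comp (op_cat (base (src m))) (Xs (tgt m)) (op_functor (mfun m))) (chi m)"
    unfolding op_functor_def
    by (rule nat_isoI_inverse[where \<sigma> = "chi n", OF is_functor_op_cat[OF F], where G = "mfun n"])
      (use inv is_acs_morD(4)[OF m] is_acs_morD(4)[OF n] in simp_all)
  moreover have "nat_iso (base (src m)) Ab (As (src m))
       (functor_comp (base (src m)) (As (tgt m)) (mfun m)) (alpha m)"
    by (rule nat_isoI_inverse[where \<sigma> = "alpha n", OF F, where G = "mfun n"])
      (use inv is_acs_morD(5)[OF m] is_acs_morD(5)[OF n] in simp_all)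
  ultimately show ?thesis by (simp add: componentwise_iso_def)
qed

text \<open>The inverse is assembled from the inverse functor and the two families of
  \<open>nat_iso_inverse\<close>. What remains is condition (p) for it.\<close>

lemma acs_mor_inverse:
  fixes m :: "('v, 'x, 'a, ('v, 'x, 'a, 'z) acs_scheme) cs_mor"
  assumes m: "is_acs_mor m" and "componentwise_iso m"
  obtains n where "is_acs_mor n" "mutually_inverse m n"
proof -
  let ?C = "base (src m)" and ?D = "base (tgt m)"
  define F where "F = mfun m"
  note acs = is_acs_morD(1,2)[OF m]
  note functors = is_acsD(1,2)[OF acs(1)] is_acsD(1,2)[OF acs(2)]
  interpret C: category ?C using acs(1) by (rule category_base)
  interpret D: category ?D using acs(2) by (rule category_base)
  have F: "is_functor ?C ?D F" using is_acs_morD(3)[OF m] by (simp add: F_def)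
  obtain G where G: "is_functor ?D ?C G" and GF: "functor_comp ?C G F = id_functor ?C"
    and FG: "functor_comp ?D F G = id_functor ?D"
    using assms(2) by (auto simp: componentwise_iso_def iso_of_categories_def F_def)
  have "nat_iso (op_cat ?C) Ab (Xs (src m)) (functor_comp (op_cat ?C) (Xs (tgt m)) F) (chi m)"
    using assms(2) by (simp add: componentwise_iso_def op_functor_def F_def)
  then obtain \<chi> where \<chi>: "nat_trans (op_cat ?D) Ab (Xs (tgt m)) (functor_comp (op_cat ?D) (Xs (src m)) G) \<chi>"
    and \<chi>1: "\<And>c. c \<in> Obj ?C \<Longrightarrow> Cmp Ab (\<chi> (Fobj F c)) (chi m c) = Idn Ab (Fobj (Xs (src m)) c)"
    and \<chi>2: "\<And>d. d \<in> Obj ?D \<Longrightarrow> Cmp Ab (chi m (Fobj G d)) (\<chi> d) = Idn Ab (Fobj (Xs (tgt m)) d)"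
    using nat_iso_inverse[OF C.category_op_cat D.category_op_cat category_Ab
        is_functor_op_cat[OF F] is_functor_op_cat[OF G], of "Xs (tgt m)" "Xs (src m)" "chi m"]
      GF FG functors by (metis functor_comp_op_cat id_functor_op_cat op_cat_simps(1))
  have "nat_iso ?C Ab (As (src m)) (functor_comp ?C (As (tgt m)) F) (alpha m)"
    using assms(2) by (simp add: componentwise_iso_def F_def)
  then obtain \<alpha> where \<alpha>: "nat_trans ?D Ab (As (tgt m)) (functor_comp ?D (As (src m)) G) \<alpha>"
    and \<alpha>1: "\<And>c. c \<in> Obj ?C \<Longrightarrow> Cmp Ab (\<alpha> (Fobj F c)) (alpha m c) = Idn Ab (Fobj (As (src m)) c)"
    and \<alpha>2: "\<And>d. d \<in> Obj ?D \<Longrightarrow> Cmp Ab (alpha m (Fobj G d)) (\<alpha> d) = Idn Ab (Fobj (As (tgt m)) d)"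
    using nat_iso_inverse[OF C.category_axioms D.category_axioms category_Ab F G GF FG functors(4)]
    by metis
  define n :: "('v, 'x, 'a, ('v, 'x, 'a, 'z) acs_scheme) cs_mor"
    where "n = \<lparr>src = tgt m, tgt = src m, mfun = G, chi = \<chi>, alpha = \<alpha>\<rparr>"
  have "mutually_inverse m n"
    using GF FG \<chi>1 \<chi>2 \<alpha>1 \<alpha>2
    by (auto simp: mutually_inverse_def n_def cs_comp_def cs_id_def F_def[symmetric]
        intro!: restrict_ext)
  moreover have "amap (\<alpha> d) (fct (tgt m) d x) = fct (src m) (Fobj G d) (amap (\<chi> d) x)"
    if d: "d \<in> Obj ?D" and x: "x \<in> carrier (Fobj (Xs (tgt m)) d)" for d x
  proof -
    define c where "c = Fobj G d"
    have c: "c \<in> Obj ?C" and Fc: "Fobj F c = d"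
      using d is_functorD(1)[OF G] functor_comp_id_apply(1)[OF FG] by (simp_all add: c_def)
    \<comment> \<open>Since \<open>chi m c\<close> carries \<open>y\<close> back to
      \<open>x\<close>, condition (p) of \<open>m\<close> at \<open>y\<close> expresses
      \<open>fct (tgt m) d x\<close> as a value of \<open>alpha m c\<close>, which
      \<open>\<alpha> d\<close> cancels.\<close>
    define y where "y = amap (\<chi> d) x"
    have y: "y \<in> carrier (Fobj (Xs (src m)) c)"
      using amap_closed[of "\<chi> d" x] nat_transD(1-3)[OF \<chi>, of d] d x
      by (simp add: y_def c_def functor_comp_apply)
    have x_eq: "amap (chi m c) y = x"
      unfolding y_def
      by (rule amap_inverse) (use nat_transD(2)[OF \<chi>, of d] \<chi>2[OF d] d x in \<open>simp_all add: c_def\<close>)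
    have "amap (\<alpha> d) (fct (tgt m) d x) = amap (\<alpha> d) (amap (alpha m c) (fct (src m) c y))"
      using is_acs_morD(6)[OF m c y] by (simp add: x_eq Fc F_def[symmetric])
    also have "\<dots> = fct (src m) c y"
      by (rule amap_inverse)
        (use \<alpha>1[OF c] nat_transD(2)[OF is_acs_morD(5)[OF m] c] is_acsD(3)[OF acs(1) c y] in
          \<open>simp_all add: Fc\<close>)
    finally show ?thesis by (simp add: y_def c_def)
  qed
  then have "is_acs_mor n"
    using acs G \<chi> \<alpha> by (simp add: is_acs_mor_def n_def op_functor_def)
  ultimately show thesis using that by blast
qed

text \<open>Condition (q) passes to the inverse: dualizing reverses composition, so pulling back
  along \<open>alpha m c\<close> and then along \<open>alpha n d\<close> is pulling back along their
  composite, the identity.\<close>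

lemma aqcs_mor_inverse:
  assumes m: "is_aqcs_mor m" and n: "is_acs_mor n" and mn: "mutually_inverse m n"
  shows "is_aqcs_mor n"
proof -
  \<comment> \<open>Facts 3 to 5 describe \<open>n\<close> after \<open>m\<close>; facts 6 to 8 are
    their analogues for \<open>m\<close> after \<open>n\<close>.\<close>
  note inv = mutually_inverseD[OF mn] mutually_inverseD(3-)[OF mutually_inverse_sym[OF mn]]
  have acs: "is_acs_mor m" and "is_aqcs (src m)" "is_aqcs (tgt m)"
    using m by (simp_all add: is_aqcs_mor_def)
  have "qfct (tgt m) d a =
      amap (dual_arrow (alpha n d)) (qfct (src m) (Fobj (mfun n) d) (amap (alpha n d) a))"
    if d: "d \<in> Obj (base (tgt m))" and a: "a \<in> carrier (Fobj (As (tgt m)) d)" for d a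
  proof -
    define c where "c = Fobj (mfun n) d"
    have c: "c \<in> Obj (base (src m))" and Fc: "Fobj (mfun m) c = d"
      using d is_functorD(1)[OF is_acs_morD(3)[OF n]]
        functor_comp_id_apply(1)[OF inv(6)[unfolded inv(1)]] by (simp_all add: inv c_def)
    have \<alpha>n: "alpha n d \<in> Arr Ab" "Dom Ab (alpha n d) = Fobj (As (tgt m)) d"
      "Cod Ab (alpha n d) = Fobj (As (src m)) c"
      using nat_transD(1-3)[OF is_acs_morD(5)[OF n], of d] d
      by (simp_all add: inv functor_comp_apply c_def)
    have \<alpha>m: "alpha m c \<in> Arr Ab" "Dom Ab (alpha m c) = Fobj (As (src m)) c"
      "Cod Ab (alpha m c) = Fobj (As (tgt m)) d"
      using nat_transD(1-3)[OF is_acs_morD(5)[OF acs], of c] c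
      by (simp_all add: functor_comp_apply Fc)
    have cancel: "amap (alpha m c) (amap (alpha n d) b) = b" if "b \<in> carrier (Fobj (As (tgt m)) d)" for b
      by (rule amap_inverse) (use inv(8)[of d] d that in \<open>simp_all add: inv \<alpha>n c_def\<close>)
    define \<phi> where "\<phi> = qfct (tgt m) d a"
    have \<phi>: "\<phi> \<in> ab_hom (Fobj (As (tgt m)) d) integer_group"
    proof -
      have "qfct (tgt m) d \<in> ab_hom (Fobj (As (tgt m)) d) (dual_group (Fobj (As (tgt m)) d))"
        using \<open>is_aqcs (tgt m)\<close> d
        by (simp add: is_aqcs_def factorization_co_contra_def dual_functor_def)
      then show ?thesis using a by (auto simp: \<phi>_def ab_hom_def hom_def dual_group_def)
    qed
    define \<psi> where "\<psi> = qfct (src m) c (amap (alpha n d) a)"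
    have b: "amap (alpha n d) a \<in> carrier (Fobj (As (src m)) c)"
      using amap_closed[OF \<alpha>n(1)] a by (simp add: \<alpha>n)
    \<comment> \<open>Condition (q) of \<open>m\<close> at the element
      \<open>amap (alpha n d) a\<close>, which \<open>alpha m c\<close> sends back to
      \<open>a\<close>.\<close>
    have "\<psi> = amap (dual_arrow (alpha m c)) \<phi>"
      using m c b a by (simp add: is_aqcs_mor_def \<psi>_def \<phi>_def Fc cancel)
    then have \<psi>_eq: "\<psi> = (\<lambda>b\<in>carrier (Fobj (As (src m)) c). \<phi> (amap (alpha m c) b))"
      using \<phi> amap_dual_arrow[of \<phi> "alpha m c"] by (simp add: \<alpha>m)
    have "\<psi> \<in> ab_hom (Fobj (As (src m)) c) integer_group"
    proof -
      have "qfct (src m) c \<in> ab_hom (Fobj (As (src m)) c) (dual_group (Fobj (As (src m)) c))"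
        using \<open>is_aqcs (src m)\<close> c
        by (simp add: is_aqcs_def factorization_co_contra_def dual_functor_def)
      then show ?thesis using b by (auto simp: \<psi>_def ab_hom_def hom_def dual_group_def)
    qed
    then have "amap (dual_arrow (alpha n d)) \<psi> =
        (\<lambda>b\<in>carrier (Fobj (As (tgt m)) d). \<psi> (amap (alpha n d) b))"
      using amap_dual_arrow[of \<psi> "alpha n d"] by (simp add: \<alpha>n)
    also have "\<dots> = (\<lambda>b\<in>carrier (Fobj (As (tgt m)) d). \<phi> b)"
      using amap_closed[OF \<alpha>n(1)] by (intro restrict_ext) (simp add: \<psi>_eq \<alpha>n cancel)
    \<comment> \<open>Agreement on the carrier becomes equality of functions because \<phi> is
      extensional.\<close>
    also have "\<dots> = \<phi>" using \<phi> by (intro extensional_restrict) (simp add: ab_hom_def)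
    finally show ?thesis by (simp add: \<phi>_def \<psi>_def c_def)
  qed
  then show ?thesis
    using n \<open>is_aqcs (src m)\<close> \<open>is_aqcs (tgt m)\<close> by (simp add: is_aqcs_mor_def inv)
qed

section \<open>Isomorphisms in the two categories of cluster structures\<close>

lemma iso_in_ACS:
  assumes "is_acs_mor m"
  shows "iso_in ACS m \<longleftrightarrow> componentwise_iso m"
proof -
  have "iso_in ACS m \<longleftrightarrow> (\<exists>n. is_acs_mor n \<and> mutually_inverse m n)"
    using assms by (auto simp: iso_in_def ACS_def mutually_inverse_def)
  then show ?thesis using componentwise_isoI[OF assms] acs_mor_inverse[OF assms] by metis
qed

text \<open>An inverse among morphisms of abstract cluster structures automatically respects the
  quantum data, so the criterion reduces to the one without it.\<close>

lemma iso_in_AQCS: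
  assumes "is_aqcs_mor m"
  shows "iso_in AQCS m \<longleftrightarrow> componentwise_iso m"
proof -
  have m: "is_acs_mor m" using assms by (simp add: is_aqcs_mor_def)
  have "iso_in AQCS m \<longleftrightarrow> (\<exists>n. is_aqcs_mor n \<and> mutually_inverse m n)"
    using assms by (auto simp: iso_in_def AQCS_def mutually_inverse_def)
  also have "\<dots> \<longleftrightarrow> (\<exists>n. is_acs_mor n \<and> mutually_inverse m n)"
    using aqcs_mor_inverse[OF assms] by (auto simp: is_aqcs_mor_def)
  finally show ?thesis using componentwise_isoI[OF m] acs_mor_inverse[OF m] by metis
qed

theorem proposition3p6:
  fixes m :: "('v, 'x, 'a, ('v, 'x, 'a) acs) cs_mor"
    and n :: "('v, 'x, 'a, ('v, 'x, 'a) aqcs) cs_mor"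
  shows "(m \<in> Arr ACS \<longrightarrow>
      (iso_in ACS m \<longleftrightarrow>
        iso_of_categories (base (src m)) (base (tgt m)) (mfun m) \<and>
        nat_iso (op_cat (base (src m))) Ab (Xs (src m))
          (functor_comp (op_cat (base (src m))) (Xs (tgt m)) (op_functor (mfun m))) (chi m) \<and>
        nat_iso (base (src m)) Ab (As (src m))
          (functor_comp (base (src m)) (As (tgt m)) (mfun m)) (alpha m)))
    \<and> (n \<in> Arr AQCS \<longrightarrow>
      (iso_in AQCS n \<longleftrightarrow>
        iso_of_categories (base (src n)) (base (tgt n)) (mfun n) \<and>
        nat_iso (op_cat (base (src n))) Ab (Xs (src n))
          (functor_comp (op_cat (base (src n))) (Xs (tgt n)) (op_functor (mfun n))) (chi n) \<and>
        nat_iso (base (src n)) Ab (As (src n))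
          (functor_comp (base (src n)) (As (tgt n)) (mfun n)) (alpha n)))"
  using iso_in_ACS[of m] iso_in_AQCS[of n]
  by (simp add: ACS_def AQCS_def componentwise_iso_def)

end
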